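(* Assume that the integers $n_1,\ldots,n_k$ generate a minimal Hilbert basis. Then the map $$\mathfrak{h}\times\mathfrak{v}\ \mapsto\ \mathfrak{F}_{\mathfrak{h}\times\mathfrak{v}}$$ is a one-to-one correspondence between the subsets of $\{1,\ldots,k\}\times\{1,\ldots,k\}$ of the form $\mathfrak{h}\times\mathfrak{v}$ (with $\mathfrak{h},\mathfrak{v}\subset\{1,\ldots,k\}$) and the faces of the cone $\mathbb{R}_{\ge 0}\cdot S_{n_1,\ldots,n_k}$.
   Context: Let $k>1$ and let $n_1,\ldots,n_k$ be positive integers with $\gcd(n_1,\ldots,n_k)=1$. Put $d_i=\gcd(n_1,\ldots,n_{i-1},n_{i+1},\ldots,n_k)$. The integers $n_1,\ldots,n_k$ are said to generate a minimal Hilbert basis if $n_i=d_1\cdots d_{i-1}d_{i+1}\cdots d_k$ for all $i=1,\ldots,k$. Let $e_1,\ldots,e_k,\overline{e}_1,\ldots,\overline{e}_k$ be the standard basis of $\mathbb{Z}^k\times\mathbb{Z}^k$. $S_{n_1,\ldots,n_k}$ is the additive monoid of all $(a,b)\in\mathbb{Z}_{\ge 0}^k\times\mathbb{Z}_{\ge 0}^k$ with $\sum_{i=1}^k n_i(a_i-b_i)=0$. $\mathbb{R}_{\ge0}\cdot S_{n_1,\ldots,n_k}$ is the convex cone in $\mathbb{R}^k\times\mathbb{R}^k$ spanned by $S_{n_1,\ldots,n_k}$ with nonnegative real coefficients; it is a strongly convex polyhedral cone. For $\mathfrak{h},\mathfrak{v}\subset\{1,\ldots,k\}$, $$\mathfrak{F}_{\mathfrak{h}\times\mathfrak{v}}=\mathbb{R}_{\ge0}\cdot\{d_ie_i+d_j\overline{e}_j:(i,j)\in\mathfrak{h}\times\mathfrak{v}\},$$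 the set of all nonnegative real combinations of the listed vectors (equal to $\{0\}$ if $\mathfrak{h}\times\mathfrak{v}=\emptyset$). A face of a cone $\gamma$ is a set of the form $\gamma\cap v^{\perp}$ with $v$ a linear functional that is nonnegative on $\gamma$ (so $\{0\}$ and $\gamma$ itself are faces here). *)

theory Defs
  imports "HOL-Analysis.Analysis"
begin

text \<open>
  The index set \<open>{1, \<dots>, k}\<close> is a finite type \<open>'k\<close> with \<open>k = CARD('k)\<close>, and
  \<open>\<real>\<^sup>k \<times> \<real>\<^sup>k\<close> is \<open>(real ^ 'k) \<times> (real ^ 'k)\<close>.
\<close>

definition cofactor_gcd :: "('k::finite \<Rightarrow> nat) \<Rightarrow> 'k \<Rightarrow> nat"
  where "cofactor_gcd n i = Gcd (n ` (UNIV - {i}))"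

definition generates_minimal_Hilbert_basis :: "('k::finite \<Rightarrow> nat) \<Rightarrow> bool"
  where "generates_minimal_Hilbert_basis n \<longleftrightarrow>
    (\<forall>i. n i = (\<Prod>j\<in>UNIV - {i}. cofactor_gcd n j))"

definition S_monoid :: "('k::finite \<Rightarrow> nat) \<Rightarrow> ((int ^ 'k) \<times> (int ^ 'k)) set"
  where "S_monoid n =
    {(a, b). (\<forall>i. 0 \<le> a $ i) \<and> (\<forall>i. 0 \<le> b $ i) \<and>
             (\<Sum>i\<in>UNIV. int (n i) * (a $ i - b $ i)) = 0}"

definition real_of_int_pair :: "(int ^ 'k) \<times> (int ^ 'k) \<Rightarrow> (real ^ 'k) \<times> (real ^ 'k)"
  where "real_of_int_pair = (\<lambda>(a, b). (\<chi> i. real_of_int (a $ i), \<chi> i. real_of_int (b $ i)))"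

text \<open>
  \<open>convex_cone hull X\<close> is the set of all nonnegative real combinations of elements of \<open>X\<close>;
  in particular it is \<open>{0}\<close> for empty \<open>X\<close>.
\<close>

lemma convex_cone_hull_explicit:
  fixes X :: "'a::real_vector set"
  shows "convex_cone hull X =
    {\<Sum>x\<in>T. c x *\<^sub>R x | T c. finite T \<and> T \<subseteq> X \<and> (\<forall>x\<in>T. 0 \<le> c x)}" (is "_ = ?R")
proof (rule hull_unique)
  show "X \<subseteq> ?R"
  proof
    fix x assume "x \<in> X"
    then show "x \<in> ?R"
      by (intro CollectI exI[of _ "{x}"] exI[of _ "\<lambda>_. 1"]) simp
  qed
  show "convex_cone ?R"
    unfolding convex_cone_iff
  proof (intro conjI ballI allI impI)
    show "0 \<in> ?R"
      by (intro CollectI exI[of _ "{}"] exI[of _ "\<lambda>_. 0"]) simp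
  next
    fix x y assume "x \<in> ?R" "y \<in> ?R"
    then obtain T c U d where
      T: "finite T" "T \<subseteq> X" "\<forall>x\<in>T. 0 \<le> c x" "x = (\<Sum>z\<in>T. c z *\<^sub>R z)" and
      U: "finite U" "U \<subseteq> X" "\<forall>x\<in>U. 0 \<le> d x" "y = (\<Sum>z\<in>U. d z *\<^sub>R z)"
      by blast
    define e where "e z = (if z \<in> T then c z else 0) + (if z \<in> U then d z else 0)" for z
    have "x = (\<Sum>z\<in>T \<union> U. (if z \<in> T then c z else 0) *\<^sub>R z)"
      unfolding T(4) by (rule sum.mono_neutral_cong_left) (use T U in auto)
    moreover have "y = (\<Sum>z\<in>T \<union> U. (if z \<in> U then d z else 0) *\<^sub>R z)"
      unfolding U(4) by (rule sum.mono_neutral_cong_left) (use T U in auto)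
    ultimately have "x + y = (\<Sum>z\<in>T \<union> U. e z *\<^sub>R z)"
      by (simp add: e_def scaleR_left_distrib sum.distrib)
    moreover have "\<forall>z\<in>T \<union> U. 0 \<le> e z"
      using T(3) U(3) by (simp add: e_def)
    ultimately show "x + y \<in> ?R"
      using T(1,2) U(1,2) by (intro CollectI exI[of _ "T \<union> U"] exI[of _ e]) simp
  next
    fix x and r :: real assume "x \<in> ?R" "0 \<le> r"
    then obtain T c where
      T: "finite T" "T \<subseteq> X" "\<forall>x\<in>T. 0 \<le> c x" "x = (\<Sum>z\<in>T. c z *\<^sub>R z)"
      by blast
    then show "r *\<^sub>R x \<in> ?R"
      using \<open>0 \<le> r\<close>
      by (intro CollectI exI[of _ T] exI[of _ "\<lambda>z. r * c z"]) (simp add: scaleR_sum_right)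
  qed
next
  fix C assume C: "X \<subseteq> C" "convex_cone C"
  show "?R \<subseteq> C"
  proof clarify
    fix T c assume "finite T" "T \<subseteq> X" "\<forall>x\<in>T. 0 \<le> (c x :: real)"
    then show "(\<Sum>x\<in>T. c x *\<^sub>R x) \<in> C"
    proof (induction T rule: finite_induct)
      case empty
      then show ?case using C(2) by (simp add: convex_cone_iff)
    next
      case (insert x T)
      then show ?case using C by (auto intro!: convex_cone_add convex_cone_scaleR)
    qed
  qed
qed

definition S_cone :: "('k::finite \<Rightarrow> nat) \<Rightarrow> ((real ^ 'k) \<times> (real ^ 'k)) set"
  where "S_cone n = convex_cone hull (real_of_int_pair ` S_monoid n)"

text \<open>Here \<open>e\<^sub>i = (axis i 1, 0)\<close> and the barred vector with index \<open>j\<close> is \<open>(0, axis j 1)\<close>.\<close>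

definition F_cone :: "('k::finite \<Rightarrow> nat) \<Rightarrow> ('k \<times> 'k) set \<Rightarrow> ((real ^ 'k) \<times> (real ^ 'k)) set"
  where "F_cone n P = convex_cone hull
    {real (cofactor_gcd n i) *\<^sub>R (axis i 1, 0) + real (cofactor_gcd n j) *\<^sub>R (0, axis j 1)
      | i j. (i, j) \<in> P}"

text \<open>
  Unlike \<open>(exposed_face_of)\<close>, this uses only supporting hyperplanes through the origin,
  so the empty set is not a face of a cone.
\<close>

definition face_of_cone :: "'a::real_vector set \<Rightarrow> 'a set \<Rightarrow> bool"
  where "face_of_cone F C \<longleftrightarrow>
    (\<exists>v :: 'a \<Rightarrow> real. linear v \<and> (\<forall>x\<in>C. 0 \<le> v x) \<and> F = C \<inter> {x. v x = 0})"

end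

theory Submission
  imports Defs
begin

text \<open>
  Minimality says exactly that \<open>n i * d i\<close> is the same number \<open>D = (\<Prod>j. d j)\<close> for all \<open>i\<close>, where
  \<open>d i\<close> is the \<open>i\<close>-th cofactor gcd; hence every generator \<open>(d\<^sub>i e\<^sub>i, d\<^sub>j e\<^sub>j)\<close> satisfies the balance equation
  \<open>\<Sum>i. n i * x i = \<Sum>j. n j * y j\<close>. Conversely, a nonnegative balanced pair \<open>(x, y)\<close> is a
  transportation problem with supplies \<open>n i * x i\<close> and demands \<open>n j * y j\<close>, solved by shipping
  from \<open>i\<close> to \<open>j\<close> in proportion to supply times demand. This writes \<open>(x, y)\<close> as a
  nonnegative combination of the generators with \<open>i\<close> in the support of \<open>x\<close> and \<open>j\<close> in the support of
  \<open>y\<close> (lemma \<open>balanced_cone_eq_F_cone\<close>). Therefore \<open>\<FF>\<^bsub>H\<times>V\<^esub>\<close> is cut out of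
  the cone by support conditions, and the cone itself is \<open>\<FF>\<^bsub>H\<times>V\<^esub>\<close> for the full index sets.

  The rest follows from this description. The support conditions amount to the vanishing of the sum
  of the excluded coordinates, so \<open>\<FF>\<^bsub>H\<times>V\<^esub>\<close> is a face; it contains the generator
  with indices \<open>(i, j)\<close> only if \<open>(i, j) \<in> H \<times> V\<close>, so it determines \<open>H \<times> V\<close>. Finally, a functional that
  is nonnegative on the cone takes the form \<open>\<alpha> i + \<beta> j\<close> on the generators, and where a nonnegative
  function of this form vanishes is a rectangle. A face is spanned by the generators in it,
  hence is \<open>\<FF>\<^bsub>H\<times>V\<^esub>\<close> for that rectangle.
\<close>

section \<open>Generators and balanced pairs\<close>

definition generator :: "('k::finite \<Rightarrow> nat) \<Rightarrow> 'k \<Rightarrow> 'k \<Rightarrow> (real ^ 'k) \<times> (real ^ 'k)"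
  where "generator n i j =
    real (cofactor_gcd n i) *\<^sub>R (axis i 1, 0) + real (cofactor_gcd n j) *\<^sub>R (0, axis j 1)"

definition balanced_cone :: "('k::finite \<Rightarrow> nat) \<Rightarrow> 'k set \<Rightarrow> 'k set \<Rightarrow> ((real ^ 'k) \<times> (real ^ 'k)) set"
  where "balanced_cone n H V =
    {(x, y). (\<forall>i. 0 \<le> x $ i \<and> 0 \<le> y $ i) \<and> (\<forall>i. i \<notin> H \<longrightarrow> x $ i = 0) \<and>
             (\<forall>j. j \<notin> V \<longrightarrow> y $ j = 0) \<and>
             (\<Sum>i\<in>UNIV. real (n i) * x $ i) = (\<Sum>j\<in>UNIV. real (n j) * y $ j)}"

lemma F_cone_eq_hull_generators: "F_cone n P = convex_cone hull {generator n i j | i j. (i, j) \<in> P}"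
  by (simp add: F_cone_def generator_def)

lemma fst_generator: "fst (generator n i j) $ l = (if l = i then real (cofactor_gcd n i) else 0)"
  and snd_generator: "snd (generator n i j) $ l = (if l = j then real (cofactor_gcd n j) else 0)"
  by (auto simp: generator_def axis_def)

lemma convex_cone_balanced_cone: "convex_cone (balanced_cone n H V)"
proof -
  have "(\<Sum>i\<in>UNIV. real (n i) * (c * x $ i)) = c * (\<Sum>i\<in>UNIV. real (n i) * x $ i)"
    for c and x :: "real ^ 'a"
    by (simp add: sum_distrib_left mult_ac)
  then show ?thesis
    unfolding convex_cone_iff balanced_cone_def
    by (auto simp: zero_prod_def distrib_left sum.distrib)
qed

lemma convex_cone_sum:
  assumes "convex_cone C" "\<And>i. i \<in> I \<Longrightarrow> f i \<in> C"
  shows "sum f I \<in> C"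
  using assms(2)
  by (induction I rule: infinite_finite_induct)
     (auto intro: convex_cone_add assms(1) convex_cone_contains_0)

lemma sum_weighted_generator:
  "(\<Sum>l\<in>UNIV. real (n l) * fst (generator n i j) $ l) = real (n i * cofactor_gcd n i)"
  "(\<Sum>l\<in>UNIV. real (n l) * snd (generator n i j) $ l) = real (n j * cofactor_gcd n j)"
  by (simp_all add: fst_generator snd_generator if_distrib[of "\<lambda>t. _ * t"] cong: if_cong)

context
  fixes n :: "'k::finite \<Rightarrow> nat"
  assumes card: "CARD('k) > 1" and pos: "\<And>i. n i > 0" and minimal: "generates_minimal_Hilbert_basis n"
begin

lemma weight_times_cofactor_gcd: "n i * cofactor_gcd n i = (\<Prod>j\<in>UNIV. cofactor_gcd n j)"
proof -
  have "n i = (\<Prod>j\<in>UNIV - {i}. cofactor_gcd n j)"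
    using minimal by (simp add: generates_minimal_Hilbert_basis_def)
  then show ?thesis
    by (simp add: prod.remove[of UNIV i] mult.commute)
qed

text \<open>There is a second index \<open>j\<close>, and \<open>cofactor_gcd n i\<close> divides the positive number \<open>n j\<close>.\<close>

lemma cofactor_gcd_pos: "cofactor_gcd n i > 0"
proof -
  have "UNIV \<noteq> {i}"
    using card by (metis is_singletonI is_singleton_altdef less_irrefl)
  then obtain j where "j \<noteq> i"
    by auto
  then have "cofactor_gcd n i dvd n j"
    unfolding cofactor_gcd_def by (intro Gcd_dvd) auto
  then show ?thesis
    using pos[of j] by (auto intro: gr0I)
qed

lemma generator_in_balanced_cone_iff: "generator n i j \<in> balanced_cone n H V \<longleftrightarrow> i \<in> H \<and> j \<in> V"
proof -
  have "balanced_cone n H V = {z. (\<forall>i. 0 \<le> fst z $ i \<and> 0 \<le> snd z $ i) \<and>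
      (\<forall>i. i \<notin> H \<longrightarrow> fst z $ i = 0) \<and> (\<forall>j. j \<notin> V \<longrightarrow> snd z $ j = 0) \<and>
      (\<Sum>i\<in>UNIV. real (n i) * fst z $ i) = (\<Sum>j\<in>UNIV. real (n j) * snd z $ j)}"
    by (auto simp: balanced_cone_def)
  then show ?thesis
    using cofactor_gcd_pos[of i] cofactor_gcd_pos[of j]
    by (simp add: sum_weighted_generator weight_times_cofactor_gcd)
       (auto simp: fst_generator snd_generator)
qed

text \<open>
  The shipment from \<open>i\<close> to \<open>j\<close> is supply times demand over the total \<open>s\<close>; dividing it by \<open>D\<close>
  converts it to a multiple of the generator, which carries \<open>n i * d i = D\<close>.
  If \<open>s = 0\<close> then \<open>x = y = 0\<close>, and the formula still holds because division by zero yields zero.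
\<close>

lemma transport_decomposition:
  fixes x y :: "real ^ 'k"
  defines "s \<equiv> (\<Sum>i\<in>UNIV. real (n i) * x $ i)"
    and "D \<equiv> real (\<Prod>j\<in>UNIV. cofactor_gcd n j)"
  assumes nonneg: "\<And>i. 0 \<le> x $ i" "\<And>i. 0 \<le> y $ i"
    and bal: "(\<Sum>j\<in>UNIV. real (n j) * y $ j) = s"
  shows "(x, y) = (\<Sum>i\<in>UNIV. \<Sum>j\<in>UNIV.
    (real (n i) * x $ i * (real (n j) * y $ j) / (s * D)) *\<^sub>R generator n i j)" (is "_ = ?R")
proof -
  have D: "real (n i) * real (cofactor_gcd n i) = D" for i
    unfolding D_def weight_times_cofactor_gcd[of i, symmetric] by simp
  have "D > 0"
    unfolding D_def using cofactor_gcd_pos by (simp add: prod_pos)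
  have zero: "x $ i = 0 \<and> y $ i = 0" if "s = 0" for i
  proof -
    have "real (n i) * x $ i = 0"
      using that nonneg sum_nonneg_eq_0_iff[of UNIV "\<lambda>i. real (n i) * x $ i"] by (simp add: s_def)
    moreover have "real (n i) * y $ i = 0"
      using that nonneg bal sum_nonneg_eq_0_iff[of UNIV "\<lambda>i. real (n i) * y $ i"] by simp
    ultimately show ?thesis
      using pos[of i] by simp
  qed
  have "fst ?R $ l = x $ l" for l
  proof -
    have "fst ?R $ l = (\<Sum>i\<in>UNIV. \<Sum>j\<in>UNIV.
        real (n i) * x $ i * (real (n j) * y $ j) / (s * D) * fst (generator n i j) $ l)"
      by (simp add: fst_sum)
    also have "\<dots> = (\<Sum>i\<in>UNIV. if l = i
        then \<Sum>j\<in>UNIV. real (n i) * x $ i * (real (n j) * y $ j) / (s * D) * real (cofactor_gcd n i)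
        else 0)"
      by (rule sum.cong) (simp_all add: fst_generator)
    also have "\<dots> = (real (n l) * real (cofactor_gcd n l)) * x $ l * (\<Sum>j\<in>UNIV. real (n j) * y $ j) / (s * D)"
      by (simp add: sum_distrib_left sum_divide_distrib mult_ac)
    also have "\<dots> = x $ l"
      using \<open>D > 0\<close> zero[of l] by (cases "s = 0") (simp_all add: D bal)
    finally show ?thesis .
  qed
  moreover have "snd ?R $ l = y $ l" for l
  proof -
    have "snd ?R $ l = (\<Sum>i\<in>UNIV.
        real (n i) * x $ i * (real (n l) * y $ l) / (s * D) * real (cofactor_gcd n l))"
      by (simp add: snd_sum snd_generator if_distrib[of "\<lambda>t. _ * t"] cong: if_cong)
    also have "\<dots> = (real (n l) * real (cofactor_gcd n l)) * y $ l * s / (s * D)"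
      by (simp add: s_def sum_distrib_left sum_divide_distrib mult_ac)
    also have "\<dots> = y $ l"
      using \<open>D > 0\<close> zero[of l] by (cases "s = 0") (simp_all add: D)
    finally show ?thesis .
  qed
  ultimately show ?thesis
    by (simp add: prod_eq_iff vec_eq_iff)
qed

lemma balanced_cone_eq_F_cone: "balanced_cone n H V = F_cone n (H \<times> V)"
proof
  show "F_cone n (H \<times> V) \<subseteq> balanced_cone n H V"
    unfolding F_cone_eq_hull_generators
    by (rule hull_minimal) (auto simp: generator_in_balanced_cone_iff convex_cone_balanced_cone)
  show "balanced_cone n H V \<subseteq> F_cone n (H \<times> V)"
  proof
    fix z assume z: "z \<in> balanced_cone n H V"
    obtain x y where xy: "z = (x, y)" by fastforce
    define s where "s = (\<Sum>i\<in>UNIV. real (n i) * x $ i)"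
    define D where "D = real (\<Prod>j\<in>UNIV. cofactor_gcd n j)"
    define c where "c i j = real (n i) * x $ i * (real (n j) * y $ j) / (s * D)" for i j
    have nonneg: "\<And>i. 0 \<le> x $ i" "\<And>i. 0 \<le> y $ i"
      and supp: "\<And>i. i \<notin> H \<Longrightarrow> x $ i = 0" "\<And>j. j \<notin> V \<Longrightarrow> y $ j = 0"
      and bal: "(\<Sum>j\<in>UNIV. real (n j) * y $ j) = s"
      using z by (auto simp: balanced_cone_def xy s_def)
    have cone: "convex_cone (F_cone n (H \<times> V))"
      by (simp add: F_cone_eq_hull_generators convex_cone_convex_cone_hull)
    have "c i j *\<^sub>R generator n i j \<in> F_cone n (H \<times> V)" for i j
    proof (cases "i \<in> H \<and> j \<in> V")
      case True
      then have "generator n i j \<in> F_cone n (H \<times> V)"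
        unfolding F_cone_eq_hull_generators by (intro hull_inc) auto
      moreover have "c i j \<ge> 0"
        unfolding c_def s_def D_def
        by (intro divide_nonneg_nonneg mult_nonneg_nonneg sum_nonneg nonneg of_nat_0_le_iff)
      ultimately show ?thesis
        using cone by (simp add: convex_cone_scaleR)
    next
      case False
      then have "c i j = 0"
        using supp by (auto simp: c_def)
      then show ?thesis
        using cone by (simp add: convex_cone_iff)
    qed
    then have "(\<Sum>i\<in>UNIV. \<Sum>j\<in>UNIV. c i j *\<^sub>R generator n i j) \<in> F_cone n (H \<times> V)"
      using cone by (intro convex_cone_sum) simp_all
    then show "z \<in> F_cone n (H \<times> V)"
      using transport_decomposition[of x y] nonneg bal
      unfolding xy c_def s_def D_def by simp
  qed
qed

lemma generator_in_F_cone_iff: "generator n i j \<in> F_cone n (H \<times> V) \<longleftrightarrow> (i, j) \<in> H \<times> V"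
  by (simp add: generator_in_balanced_cone_iff flip: balanced_cone_eq_F_cone)

lemma generator_in_S_cone: "generator n i j \<in> S_cone n"
proof -
  define a where "a = (\<chi> l. if l = i then int (cofactor_gcd n i) else 0)"
  define b where "b = (\<chi> l. if l = j then int (cofactor_gcd n j) else 0)"
  have "(\<Sum>l\<in>UNIV. int (n l) * (a $ l - b $ l)) = int (n i * cofactor_gcd n i) - int (n j * cofactor_gcd n j)"
    by (simp add: a_def b_def right_diff_distrib sum_subtractf if_distrib[of "\<lambda>t. _ * t"] cong: if_cong)
  then have "(a, b) \<in> S_monoid n"
    by (simp add: S_monoid_def weight_times_cofactor_gcd) (simp add: a_def b_def)
  moreover have "real_of_int_pair (a, b) = generator n i j"
    by (simp add: real_of_int_pair_def prod_eq_iff vec_eq_iff fst_generator snd_generator a_def b_def)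
  ultimately show ?thesis
    unfolding S_cone_def by (metis hull_inc imageI)
qed

lemma S_cone_eq_balanced_cone: "S_cone n = balanced_cone n UNIV UNIV"
proof
  have "real_of_int_pair z \<in> balanced_cone n UNIV UNIV" if "z \<in> S_monoid n" for z
  proof -
    obtain a b where z: "z = (a, b)" by fastforce
    have "real_of_int (\<Sum>i\<in>UNIV. int (n i) * (a $ i - b $ i)) = 0"
      using that by (simp add: z S_monoid_def)
    then show ?thesis
      using that by (simp add: z S_monoid_def real_of_int_pair_def balanced_cone_def
          right_diff_distrib sum_subtractf)
  qed
  then show "S_cone n \<subseteq> balanced_cone n UNIV UNIV"
    unfolding S_cone_def by (intro hull_minimal) (auto simp: convex_cone_balanced_cone)
  show "balanced_cone n UNIV UNIV \<subseteq> S_cone n"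
    unfolding balanced_cone_eq_F_cone F_cone_eq_hull_generators
  proof (rule hull_minimal)
    show "convex_cone (S_cone n)"
      unfolding S_cone_def by (rule convex_cone_convex_cone_hull)
  qed (auto simp: generator_in_S_cone)
qed

section \<open>Faces\<close>

lemma face_of_cone_F_cone: "face_of_cone (F_cone n (H \<times> V)) (S_cone n)"
proof -
  define v :: "(real ^ 'k) \<times> (real ^ 'k) \<Rightarrow> real"
    where "v z = (\<Sum>i\<in>-H. fst z $ i) + (\<Sum>j\<in>-V. snd z $ j)" for z
  have "linear v"
    by (rule linearI) (simp_all add: v_def sum.distrib distrib_left sum_distrib_left)
  moreover have "0 \<le> v z" if "z \<in> S_cone n" for z
    using that unfolding S_cone_eq_balanced_cone balanced_cone_def v_def
    by (auto intro!: add_nonneg_nonneg sum_nonneg)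
  moreover have "F_cone n (H \<times> V) = S_cone n \<inter> {z. v z = 0}"
  proof -
    have "v (x, y) = 0 \<longleftrightarrow> (\<forall>i. i \<notin> H \<longrightarrow> x $ i = 0) \<and> (\<forall>j. j \<notin> V \<longrightarrow> y $ j = 0)"
      if "\<And>i. 0 \<le> x $ i" "\<And>j. 0 \<le> y $ j" for x y
      using that by (auto simp: v_def add_nonneg_eq_0_iff sum_nonneg sum_nonneg_eq_0_iff)
    then show ?thesis
      unfolding S_cone_eq_balanced_cone balanced_cone_eq_F_cone[symmetric]
      by (auto simp: balanced_cone_def)
  qed
  ultimately show ?thesis
    unfolding face_of_cone_def by blast
qed

end

text \<open>In a nonnegative combination on which \<open>v\<close> vanishes, every term with \<open>v x > 0\<close> has coefficient zero.\<close>

lemma convex_cone_hull_Int_kernel: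
  fixes v :: "'a::real_vector \<Rightarrow> real"
  assumes v: "linear v" and nonneg: "\<And>x. x \<in> X \<Longrightarrow> 0 \<le> v x"
  shows "convex_cone hull X \<inter> {x. v x = 0} = convex_cone hull (X \<inter> {x. v x = 0})"
proof
  show "convex_cone hull X \<inter> {x. v x = 0} \<subseteq> convex_cone hull (X \<inter> {x. v x = 0})"
  proof clarify
    fix z assume "z \<in> convex_cone hull X" and vz: "v z = 0"
    then obtain T c where T: "finite T" "T \<subseteq> X" "\<forall>x\<in>T. 0 \<le> c x" "z = (\<Sum>x\<in>T. c x *\<^sub>R x)"
      unfolding convex_cone_hull_explicit by blast
    have "(\<Sum>x\<in>T. c x * v x) = 0"
      using vz v by (simp add: T(4) linear_sum linear_scale)
    then have *: "\<forall>x\<in>T. c x * v x = 0"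
      by (subst (asm) sum_nonneg_eq_0_iff) (use T nonneg in auto)
    have "z = (\<Sum>x\<in>T \<inter> {x. v x = 0}. c x *\<^sub>R x)"
      unfolding T(4) by (rule sum.mono_neutral_right) (use T * in auto)
    then show "z \<in> convex_cone hull (X \<inter> {x. v x = 0})"
      unfolding convex_cone_hull_explicit using T
      by (intro CollectI exI[of _ "T \<inter> {x. v x = 0}"] exI[of _ c]) auto
  qed
  have "convex_cone {x. v x = 0}"
    using v by (simp add: convex_cone_iff linear_add linear_scale linear_0)
  then have "convex_cone hull (X \<inter> {x. v x = 0}) \<subseteq> {x. v x = 0}"
    by (intro hull_minimal) auto
  then show "convex_cone hull (X \<inter> {x. v x = 0}) \<subseteq> convex_cone hull X \<inter> {x. v x = 0}"
    using hull_mono[of "X \<inter> {x. v x = 0}" X convex_cone] by auto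
qed

text \<open>
  If \<open>(i, j)\<close> and \<open>(i', j')\<close> are zeros, the values at \<open>(i, j')\<close> and \<open>(i', j)\<close> are nonnegative and have
  sum zero, so these are zeros as well.
\<close>

lemma zero_set_nonneg_separable_is_rectangle:
  fixes \<alpha> :: "'i \<Rightarrow> real" and \<beta> :: "'j \<Rightarrow> real"
  assumes nonneg: "\<And>i j. 0 \<le> \<alpha> i + \<beta> j"
  defines "Z \<equiv> {(i, j). \<alpha> i + \<beta> j = 0}"
  shows "Z = fst ` Z \<times> snd ` Z"
proof -
  have "(i, j') \<in> Z" if "(i, j) \<in> Z" "(i', j') \<in> Z" for i j i' j'
    using that nonneg[of i j'] nonneg[of i' j] by (simp add: Z_def)
  then show ?thesis
    by force
qed

theorem theorem1:
  fixes n :: "'k::finite \<Rightarrow> nat"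
  assumes "CARD('k) > 1"
    and "\<And>i. n i > 0"
    and "Gcd (range n) = 1"
    and "generates_minimal_Hilbert_basis n"
  shows "bij_betw (F_cone n)
           {H \<times> V | H V :: 'k set. True}
           {F. face_of_cone F (S_cone n)}"
  unfolding bij_betw_def
proof
  note hyps = assms(1,2,4)
  show "inj_on (F_cone n) {H \<times> V | H V :: 'k set. True}"
  proof (rule inj_onI)
    fix P Q :: "('k \<times> 'k) set"
    assume PQ: "P \<in> {H \<times> V | H V. True}" "Q \<in> {H \<times> V | H V. True}" "F_cone n P = F_cone n Q"
    have "R = {(i, j). generator n i j \<in> F_cone n R}" if "R \<in> {H \<times> V | H V. True}" for R
      using that generator_in_F_cone_iff[OF hyps] by auto
    from this[OF PQ(1)] this[OF PQ(2)] show "P = Q"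
      unfolding PQ(3) by simp
  qed
  show "F_cone n ` {H \<times> V | H V. True} = {F. face_of_cone F (S_cone n)}"
  proof (intro equalityI subsetI)
    fix F assume "F \<in> F_cone n ` {H \<times> V | H V. True}"
    then show "F \<in> {F. face_of_cone F (S_cone n)}"
      using face_of_cone_F_cone[OF hyps] by auto
  next
    fix F assume "F \<in> {F. face_of_cone F (S_cone n)}"
    then obtain v :: "(real ^ 'k) \<times> (real ^ 'k) \<Rightarrow> real"
      where v: "linear v" "\<And>z. z \<in> S_cone n \<Longrightarrow> 0 \<le> v z" "F = S_cone n \<inter> {z. v z = 0}"
      unfolding face_of_cone_def by blast
    define Z where "Z = {(i, j). v (generator n i j) = 0}"
    define \<alpha> where "\<alpha> i = v (real (cofactor_gcd n i) *\<^sub>R (axis i 1, 0))" for i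
    define \<beta> where "\<beta> j = v (real (cofactor_gcd n j) *\<^sub>R (0, axis j 1))" for j
    have split: "v (generator n i j) = \<alpha> i + \<beta> j" for i j
      unfolding generator_def \<alpha>_def \<beta>_def by (rule linear_add[OF v(1)])
    have nonneg: "0 \<le> v (generator n i j)" for i j
      by (intro v(2) generator_in_S_cone hyps)
    have "Z = fst ` Z \<times> snd ` Z"
      unfolding Z_def split
      by (rule zero_set_nonneg_separable_is_rectangle) (use nonneg in \<open>simp add: split\<close>)
    moreover have "F = F_cone n Z"
    proof -
      have "S_cone n = convex_cone hull {generator n i j | i j. True}"
        by (simp add: S_cone_eq_balanced_cone[OF hyps] balanced_cone_eq_F_cone[OF hyps]
            F_cone_eq_hull_generators)
      then have "F = convex_cone hull ({generator n i j | i j. True} \<inter> {z. v z = 0})"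
        unfolding v(3) by (simp only:) (rule convex_cone_hull_Int_kernel, use v(1) nonneg in auto)
      also have "{generator n i j | i j. True} \<inter> {z. v z = 0} = {generator n i j | i j. (i, j) \<in> Z}"
        unfolding Z_def by blast
      finally show ?thesis
        by (simp add: F_cone_eq_hull_generators)
    qed
    ultimately show "F \<in> F_cone n ` {H \<times> V | H V. True}"
      by blast
  qed
qed

end
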